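(* Let $m\in\mathbb{R}\setminus\{0\}$ and $g\in\mathbb{R}\setminus\{0\}$. Consider $(\phi_A,\phi_B,\phi_C,\omega)\in\mathbb{R}^4$ satisfying $$\omega\phi_A=g\phi_A^3-m\phi_B-m\phi_C,\quad \omega\phi_B=-m\phi_A+g\phi_B^3-m\phi_C,\quad \omega\phi_C=-m\phi_A-m\phi_B+g\phi_C^3,$$ and $\phi_A^2+\phi_B^2+\phi_C^2=1$. There is no solution in which $\phi_A,\phi_B,\phi_C$ are pairwise distinct and all non-zero. Up to permutations of $(\phi_A,\phi_B,\phi_C)$ and the global sign flip $\phi\mapsto-\phi$, the solutions are exactly the following. (Type II) $\phi=(a,b,b)$ with $a>0$, where for one of the two choices of sign $\pm$, $$b=b_\pm(a)=-\left(\frac a2+\frac{m}{ga}\pm\sqrt{\left(\frac a2\right)^2+\left(\frac{m}{ga}\right)^2}\right),\qquad \omega=\omega_\pm(a)=m+ga^2+\frac{2m^2}{ga^2}\pm m\sqrt{1+\frac{4m^2}{g^2a^4}},$$ and $a$ satisfies $a^2+2b_\pm(a)^2=1$. Any such $a$ satisfies $$3a^6+\left(\frac{4m}{g}-4\right)a^4+\left(1+\frac{12m^2}{g^2}-\frac{4m}{g}\right)a^2-\frac{8m^2}{g^2}=0 .$$ (Type III) $\phi=\frac1{\sqrt2}(1,-1,0)$ with $\omega=m+\frac g2$. (Type IV) $\phi=\frac1{\sqrt3}(1,1,1)$ with $\omega=-2m+\frac g3$.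
   Context: These equations are the conditions for a real, normalized discrete breather (time-periodic solution $e^{-i\omega t}\phi$) supported in a single three-site unit cell $\{A,B,C\}$ of the breathing kagome lattice with cubic on-site nonlinearity of strength $g$, in the limit where the inter-cell hopping vanishes and the intra-cell hopping amplitude is $-m$. *)

theory Defs
  imports "HOL-Analysis.Analysis"
begin

text \<open>
  The amplitudes on the three sites A, B, C are the components 1, 2, 3 of a vector.
\<close>

definition unit_cell_breather :: "real \<Rightarrow> real \<Rightarrow> real ^ 3 \<Rightarrow> real \<Rightarrow> bool" where
  "unit_cell_breather m g \<phi> \<omega> \<longleftrightarrow>
     \<omega> * \<phi> $ 1 = g * (\<phi> $ 1) ^ 3 - m * \<phi> $ 2 - m * \<phi> $ 3 \<and>
     \<omega> * \<phi> $ 2 = - m * \<phi> $ 1 + g * (\<phi> $ 2) ^ 3 - m * \<phi> $ 3 \<and>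
     \<omega> * \<phi> $ 3 = - m * \<phi> $ 1 - m * \<phi> $ 2 + g * (\<phi> $ 3) ^ 3 \<and>
     (\<phi> $ 1)\<^sup>2 + (\<phi> $ 2)\<^sup>2 + (\<phi> $ 3)\<^sup>2 = 1"

definition equal_up_to_perm_sign :: "real ^ 3 \<Rightarrow> real ^ 3 \<Rightarrow> bool" where
  "equal_up_to_perm_sign \<phi> \<psi> \<longleftrightarrow>
     (\<exists>p s. p permutes UNIV \<and> s \<in> {1, - 1} \<and> (\<forall>i. \<phi> $ i = s * \<psi> $ p i))"

text \<open>
  In the type II formulas the argument \<open>\<sigma>\<close>, always 1 or -1, is the choice of sign written
  as a plus-minus symbol; the amplitude and the frequency carry the same choice.
\<close>

definition typeII_amplitude :: "real \<Rightarrow> real \<Rightarrow> real \<Rightarrow> real \<Rightarrow> real" where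
  "typeII_amplitude m g \<sigma> a =
     - (a / 2 + m / (g * a) + \<sigma> * sqrt ((a / 2)\<^sup>2 + (m / (g * a))\<^sup>2))"

definition typeII_frequency :: "real \<Rightarrow> real \<Rightarrow> real \<Rightarrow> real \<Rightarrow> real" where
  "typeII_frequency m g \<sigma> a =
     m + g * a\<^sup>2 + 2 * m\<^sup>2 / (g * a\<^sup>2) + \<sigma> * (m * sqrt (1 + 4 * m\<^sup>2 / (g\<^sup>2 * a ^ 4)))"

definition typeII_parameter :: "real \<Rightarrow> real \<Rightarrow> real \<Rightarrow> real \<Rightarrow> bool" where
  "typeII_parameter m g \<sigma> a \<longleftrightarrow>
     \<sigma> \<in> {1, - 1} \<and> a > 0 \<and> a\<^sup>2 + 2 * (typeII_amplitude m g \<sigma> a)\<^sup>2 = 1"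

definition typeII :: "real \<Rightarrow> real \<Rightarrow> real ^ 3 \<Rightarrow> real \<Rightarrow> bool" where
  "typeII m g \<phi> \<omega> \<longleftrightarrow>
     (\<exists>\<sigma> a. typeII_parameter m g \<sigma> a \<and>
        \<phi> = vector [a, typeII_amplitude m g \<sigma> a, typeII_amplitude m g \<sigma> a] \<and>
        \<omega> = typeII_frequency m g \<sigma> a)"

definition typeIII :: "real \<Rightarrow> real \<Rightarrow> real ^ 3 \<Rightarrow> real \<Rightarrow> bool" where
  "typeIII m g \<phi> \<omega> \<longleftrightarrow> \<phi> = (1 / sqrt 2) *\<^sub>R vector [1, - 1, 0] \<and> \<omega> = m + g / 2"

definition typeIV :: "real \<Rightarrow> real \<Rightarrow> real ^ 3 \<Rightarrow> real \<Rightarrow> bool" where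
  "typeIV m g \<phi> \<omega> \<longleftrightarrow> \<phi> = (1 / sqrt 3) *\<^sub>R vector [1, 1, 1] \<and> \<omega> = - 2 * m + g / 3"

end

theory Submission
  imports Defs
begin

text \<open>
  With \<open>S\<close> the sum of the amplitudes, every amplitude is a root of the same cubic
  \<open>g * x ^ 3 + (m - \<omega>) * x - m * S\<close>, which has no quadratic term. Three distinct amplitudes would
  therefore be all of its roots and sum to zero, so that the constant term vanishes and one of
  them is zero. If two amplitudes coincide, eliminating \<open>\<omega>\<close> from the two remaining equations
  leaves a product of \<open>a - b\<close> and a quadratic polynomial in \<open>b\<close>.
\<close>

section \<open>Permutations and the global sign\<close>

text \<open>Written with the total sum, the three equations take one shape, so that relabelling
  sites only reindexes sums.\<close>

lemma unit_cell_breather_iff: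
  "unit_cell_breather m g \<phi> \<omega> \<longleftrightarrow>
     (\<forall>i. \<omega> * \<phi> $ i = g * (\<phi> $ i) ^ 3 - m * (sum (($) \<phi>) UNIV - \<phi> $ i)) \<and>
     (\<Sum>i\<in>UNIV. (\<phi> $ i)\<^sup>2) = 1"
  unfolding unit_cell_breather_def sum_3 forall_3 by (auto simp: algebra_simps)

lemma unit_cell_breather_vector:
  "unit_cell_breather m g (vector [x, y, z]) \<omega> \<longleftrightarrow>
     \<omega> * x = g * x ^ 3 - m * y - m * z \<and> \<omega> * y = - m * x + g * y ^ 3 - m * z \<and>
     \<omega> * z = - m * x - m * y + g * z ^ 3 \<and> x\<^sup>2 + y\<^sup>2 + z\<^sup>2 = 1"
  by (simp add: unit_cell_breather_def)

lemma equal_up_to_perm_sign_sym: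
  assumes "equal_up_to_perm_sign \<phi> \<psi>"
  shows "equal_up_to_perm_sign \<psi> \<phi>"
proof -
  obtain p s where p: "p permutes UNIV" and s: "s \<in> {1, - 1}" and e: "\<And>i. \<phi> $ i = s * \<psi> $ p i"
    using assms unfolding equal_up_to_perm_sign_def by blast
  have "\<psi> $ i = s * \<phi> $ inv p i" for i
    using s p by (auto simp: e permutes_inverses)
  then show ?thesis
    using s permutes_inv[OF p] unfolding equal_up_to_perm_sign_def by blast
qed

text \<open>A permutation fixes the sum and the norm, and the sign \<open>s\<close> factors out of
  each equation because \<open>s ^ 3 = s\<close>.\<close>

lemma unit_cell_breather_invariant:
  assumes "equal_up_to_perm_sign \<phi> \<psi>" and "unit_cell_breather m g \<psi> \<omega>"
  shows "unit_cell_breather m g \<phi> \<omega>"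
proof -
  obtain p s where p: "p permutes UNIV" and s: "s \<in> {1, - 1}" and e: "\<And>i. \<phi> $ i = s * \<psi> $ p i"
    using assms(1) unfolding equal_up_to_perm_sign_def by blast
  have S: "sum (($) \<phi>) UNIV = s * sum (($) \<psi>) UNIV"
    using sum.permute[OF p, of "($) \<psi>"] by (simp add: e o_def sum_distrib_left)
  have N: "(\<Sum>i\<in>UNIV. (\<phi> $ i)\<^sup>2) = (\<Sum>i\<in>UNIV. (\<psi> $ i)\<^sup>2)"
    using sum.permute[OF p, of "\<lambda>i. (\<psi> $ i)\<^sup>2"] s by (auto simp: e o_def power_mult_distrib)
  have "\<omega> * \<psi> $ p i = g * (\<psi> $ p i) ^ 3 - m * (sum (($) \<psi>) UNIV - \<psi> $ p i)" for i
    using assms(2) unfolding unit_cell_breather_iff by blast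
  then have "\<omega> * \<phi> $ i = g * (\<phi> $ i) ^ 3 - m * (sum (($) \<phi>) UNIV - \<phi> $ i)" for i
    using s unfolding S e by (auto simp: algebra_simps)
  then show ?thesis
    using assms(2) N unfolding unit_cell_breather_iff by simp
qed

section \<open>Three distinct amplitudes\<close>

text \<open>Vieta's relations for a cubic without quadratic term, obtained from divided differences:
  those at \<open>x, y\<close> and at \<open>x, z\<close> both vanish, and their difference has the
  factor \<open>x + y + z\<close>.\<close>

lemma depressed_cubic_distinct_roots:
  fixes x y z c g k :: real
  assumes g: "g \<noteq> 0" and ne: "x \<noteq> y" "x \<noteq> z" "y \<noteq> z"
    and r: "g * x ^ 3 + c * x = k" "g * y ^ 3 + c * y = k" "g * z ^ 3 + c * z = k"
  shows "x + y + z = 0" and "k = g * (x * y * z)"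
proof -
  have "(x - y) * (g * (x\<^sup>2 + x * y + y\<^sup>2) + c) = (g * x ^ 3 + c * x) - (g * y ^ 3 + c * y)"
    by (simp add: algebra_simps power2_eq_square power3_eq_cube)
  then have q1: "g * (x\<^sup>2 + x * y + y\<^sup>2) + c = 0"
    using ne r by simp
  have "(x - z) * (g * (x\<^sup>2 + x * z + z\<^sup>2) + c) = (g * x ^ 3 + c * x) - (g * z ^ 3 + c * z)"
    by (simp add: algebra_simps power2_eq_square power3_eq_cube)
  then have q2: "g * (x\<^sup>2 + x * z + z\<^sup>2) + c = 0"
    using ne r by simp
  have "g * (y - z) * (x + y + z) = 0"
    using q1 q2 by algebra
  then show s: "x + y + z = 0"
    using g ne by simp
  \<comment> \<open>Eliminating \<open>c\<close> by \<open>q1\<close> gives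
    \<open>k = - g * x * y * (x + y)\<close>, where \<open>x + y = - z\<close>.\<close>
  show "k = g * (x * y * z)"
    using q1 s r(1) by algebra
qed

text \<open>The zero sum is recorded as well because it makes the two amplitudes beside the zero
  opposite, which leads to type III.\<close>

lemma unit_cell_breather_distinct:
  assumes m: "m \<noteq> 0" and g: "g \<noteq> 0" and b: "unit_cell_breather m g \<phi> \<omega>"
    and ne: "\<phi> $ 1 \<noteq> \<phi> $ 2" "\<phi> $ 1 \<noteq> \<phi> $ 3" "\<phi> $ 2 \<noteq> \<phi> $ 3"
  shows "\<phi> $ 1 + \<phi> $ 2 + \<phi> $ 3 = 0" and "\<phi> $ 1 = 0 \<or> \<phi> $ 2 = 0 \<or> \<phi> $ 3 = 0"
proof -
  define k where "k = m * (\<phi> $ 1 + \<phi> $ 2 + \<phi> $ 3)"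
  have r: "g * (\<phi> $ i) ^ 3 + (m - \<omega>) * \<phi> $ i = k" for i
    using b unfolding unit_cell_breather_iff sum_3 k_def by (auto simp: algebra_simps)
  note roots = depressed_cubic_distinct_roots[OF g ne r r r]
  show "\<phi> $ 1 + \<phi> $ 2 + \<phi> $ 3 = 0"
    by (rule roots(1))
  then show "\<phi> $ 1 = 0 \<or> \<phi> $ 2 = 0 \<or> \<phi> $ 3 = 0"
    using roots(2) g unfolding k_def by simp
qed

section \<open>The type II formulas\<close>

text \<open>Complete the square in \<open>b\<close>. After division by \<open>g * a\<close> the
  constant term \<open>m / g\<close> cancels the cross term of the squared vertex, so the
  discriminant is a sum of squares and both signs give real roots.\<close>

lemma typeII_amplitude_iff:
  assumes "g \<noteq> 0" and "a \<noteq> 0"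
  shows "(\<exists>\<sigma>\<in>{1, - 1}. b = typeII_amplitude m g \<sigma> a) \<longleftrightarrow>
     g * a * b\<^sup>2 + (g * a\<^sup>2 + 2 * m) * b + m * a = 0"
proof -
  define D where "D = (a / 2)\<^sup>2 + (m / (g * a))\<^sup>2"
  define u where "u = b + (a / 2 + m / (g * a))"
  have D: "0 \<le> D"
    by (simp add: D_def)
  have "g * a * b\<^sup>2 + (g * a\<^sup>2 + 2 * m) * b + m * a = g * a * (u\<^sup>2 - D)"
    using assms unfolding u_def D_def by (simp add: field_simps power2_eq_square)
  then have "g * a * b\<^sup>2 + (g * a\<^sup>2 + 2 * m) * b + m * a = 0 \<longleftrightarrow> u\<^sup>2 = (sqrt D)\<^sup>2"
    using assms D by simp
  also have "\<dots> \<longleftrightarrow> u = sqrt D \<or> u = - sqrt D"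
    by (rule power2_eq_iff)
  also have "\<dots> \<longleftrightarrow> (\<exists>\<sigma>\<in>{1, - 1}. b = typeII_amplitude m g \<sigma> a)"
    unfolding typeII_amplitude_def u_def D_def by auto
  finally show ?thesis
    by simp
qed

text \<open>The right side is the equation at site 1 solved for the frequency. The two radicals
  agree once \<open>a / 2\<close> is pulled out of the root, which uses
  \<open>a > 0\<close>.\<close>

lemma typeII_frequency_eq:
  assumes "g \<noteq> 0" and "a > 0"
  shows "typeII_frequency m g \<sigma> a = g * a\<^sup>2 - 2 * m * typeII_amplitude m g \<sigma> a / a"
proof -
  have "sqrt ((a / 2)\<^sup>2 + (m / (g * a))\<^sup>2) = sqrt ((a / 2)\<^sup>2 * (1 + 4 * m\<^sup>2 / (g\<^sup>2 * a ^ 4)))"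
    using assms by (simp add: field_simps power2_eq_square power4_eq_xxxx)
  also have "\<dots> = a / 2 * sqrt (1 + 4 * m\<^sup>2 / (g\<^sup>2 * a ^ 4))"
    using assms unfolding real_sqrt_mult by simp
  finally show ?thesis
    using assms unfolding typeII_frequency_def typeII_amplitude_def
    by (simp add: field_simps power2_eq_square)
qed

lemma typeII_parameter_quadratic:
  assumes "g \<noteq> 0" and "typeII_parameter m g \<sigma> a" and "b = typeII_amplitude m g \<sigma> a"
  shows "g * a * b\<^sup>2 + (g * a\<^sup>2 + 2 * m) * b + m * a = 0"
  using assms typeII_amplitude_iff[of g a b m] unfolding typeII_parameter_def by force

section \<open>The listed families are solutions\<close>

lemma typeII_breather:
  assumes g: "g \<noteq> 0" and "typeII m g \<psi> \<omega>"
  shows "unit_cell_breather m g \<psi> \<omega>"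
proof -
  obtain \<sigma> a where p: "typeII_parameter m g \<sigma> a"
    and \<psi>: "\<psi> = vector [a, typeII_amplitude m g \<sigma> a, typeII_amplitude m g \<sigma> a]"
    and \<omega>: "\<omega> = typeII_frequency m g \<sigma> a"
    using assms unfolding typeII_def by blast
  define b where "b = typeII_amplitude m g \<sigma> a"
  have a: "a > 0" and n: "a\<^sup>2 + 2 * b\<^sup>2 = 1"
    using p unfolding typeII_parameter_def b_def by auto
  have q: "g * a * b\<^sup>2 + (g * a\<^sup>2 + 2 * m) * b + m * a = 0"
    using typeII_parameter_quadratic[OF g p b_def] .
  have w: "\<omega> * a = g * a ^ 3 - 2 * m * b"
    using a unfolding \<omega> typeII_frequency_eq[OF g a] b_def
    by (simp add: field_simps power2_eq_square power3_eq_cube)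
  \<comment> \<open>After inserting \<open>w\<close>, the left side is \<open>a - b\<close> times
    the quadratic in \<open>q\<close>.\<close>
  have "a * (\<omega> * b - (g * b ^ 3 - m * a - m * b)) = 0"
    using q w by algebra
  then have "\<omega> * b = g * b ^ 3 - m * a - m * b"
    using a by simp
  then show ?thesis
    using w n unfolding \<psi> b_def[symmetric] unit_cell_breather_vector by simp
qed

lemma typeIII_breather:
  assumes "typeIII m g \<psi> \<omega>"
  shows "unit_cell_breather m g \<psi> \<omega>"
  using assms unfolding typeIII_def unit_cell_breather_def
  by (auto simp: field_simps power2_eq_square power3_eq_cube)

lemma typeIV_breather:
  assumes "typeIV m g \<psi> \<omega>"
  shows "unit_cell_breather m g \<psi> \<omega>"
  using assms unfolding typeIV_def unit_cell_breather_def
  by (auto simp: field_simps power2_eq_square power3_eq_cube)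

section \<open>Two equal amplitudes\<close>

lemma unit_cell_breather_two_equal:
  assumes m: "m \<noteq> 0" and g: "g \<noteq> 0" and a: "a \<ge> 0"
    and u: "unit_cell_breather m g (vector [a, b, b]) \<omega>"
  shows "typeII m g (vector [a, b, b]) \<omega> \<or> typeIV m g (vector [a, b, b]) \<omega>"
proof -
  have e1: "\<omega> * a = g * a ^ 3 - 2 * m * b" and e2: "\<omega> * b = g * b ^ 3 - m * a - m * b"
    and n: "a\<^sup>2 + 2 * b\<^sup>2 = 1"
    using u unfolding unit_cell_breather_vector by auto
  have a0: "a > 0"
  proof (rule ccontr)
    \<comment> \<open>With \<open>a = 0\<close>, \<open>e1\<close> forces \<open>b = 0\<close>,
      against the norm.\<close>
    assume "\<not> a > 0"
    then show False
      using a m e1 n by simp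
  qed
  show ?thesis
  proof (cases "a = b")
    case True
    have "a\<^sup>2 = (1 / sqrt 3)\<^sup>2"
      using n True by (simp add: power_divide)
    then have a3: "a = 1 / sqrt 3"
      using a0 by (simp add: power2_eq_iff_nonneg)
    have "a * (\<omega> - (g * a\<^sup>2 - 2 * m)) = 0"
      using e1 True by algebra
    then have "\<omega> = g * a\<^sup>2 - 2 * m"
      using a0 by simp
    moreover have "a\<^sup>2 = 1 / 3"
      using n True by simp
    ultimately have "\<omega> = - 2 * m + g / 3"
      by simp
    then have "typeIV m g (vector [a, b, b]) \<omega>"
      unfolding typeIV_def using True a3 by (simp add: vec_eq_iff forall_3)
    then show ?thesis ..
  next
    case False
    \<comment> \<open>The frequency is eliminated by subtracting \<open>b\<close> times
      \<open>e1\<close> from \<open>a\<close> times \<open>e2\<close>.\<close>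
    have "(a - b) * (g * a * b\<^sup>2 + (g * a\<^sup>2 + 2 * m) * b + m * a) = 0"
      using e1 e2 by algebra
    then have "g * a * b\<^sup>2 + (g * a\<^sup>2 + 2 * m) * b + m * a = 0"
      using False by simp
    then obtain \<sigma> where \<sigma>: "\<sigma> \<in> {1, - 1}" and b: "b = typeII_amplitude m g \<sigma> a"
      using typeII_amplitude_iff[of g a b m] g a0 by auto
    have "\<omega> = g * a\<^sup>2 - 2 * m * b / a"
      using e1 a0 by (simp add: field_simps power2_eq_square power3_eq_cube)
    then have "\<omega> = typeII_frequency m g \<sigma> a"
      using typeII_frequency_eq[OF g a0] b by simp
    then show ?thesis
      using \<sigma> b a0 n unfolding typeII_def typeII_parameter_def by blast
  qed
qed

section \<open>Normal forms\<close>

text \<open>A transposition moves the exceptional site to position 1, and the sign of its amplitude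
  serves as the global sign, making the leading entry positive.\<close>

lemma two_equal_normal_form:
  fixes \<phi> :: "real ^ 3"
  assumes "\<phi> $ i \<noteq> 0" and "\<And>l. l \<noteq> i \<Longrightarrow> \<phi> $ l = b"
  shows "equal_up_to_perm_sign \<phi> (vector [\<bar>\<phi> $ i\<bar>, sgn (\<phi> $ i) * b, sgn (\<phi> $ i) * b])"
proof -
  define s where "s = sgn (\<phi> $ i)"
  let ?p = "Transposition.transpose i 1"
  have s: "s \<in> {1, - 1}" and s2: "s * s = 1" and s3: "s * \<bar>\<phi> $ i\<bar> = \<phi> $ i"
    using assms(1) unfolding s_def by (auto simp: sgn_if)
  have v: "vector [\<bar>\<phi> $ i\<bar>, s * b, s * b] $ j = (if j = 1 then \<bar>\<phi> $ i\<bar> else s * b)" for j :: 3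
    using exhaust_3[of j] by auto
  have "\<phi> $ l = s * (vector [\<bar>\<phi> $ i\<bar>, s * b, s * b] :: real ^ 3) $ ?p l" for l
    using s2 s3 assms(2)[of l] unfolding v
    by (auto simp: Transposition.transpose_def mult.assoc[symmetric])
  moreover have "?p permutes UNIV"
    by (simp add: permutes_swap_id)
  ultimately show ?thesis
    unfolding equal_up_to_perm_sign_def s_def[symmetric] using s by blast
qed

text \<open>Move the zero to site 3. The zero sum then makes the other two entries opposite, and the
  norm fixes their size.\<close>

lemma opposite_pair_normal_form:
  fixes \<phi> :: "real ^ 3"
  assumes "\<phi> $ k = 0" and "sum (($) \<phi>) UNIV = 0" and "(\<Sum>i\<in>UNIV. (\<phi> $ i)\<^sup>2) = 1"
  shows "equal_up_to_perm_sign \<phi> ((1 / sqrt 2) *\<^sub>R vector [1, - 1, 0])"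
proof -
  let ?p = "Transposition.transpose k 3"
  have p: "?p permutes UNIV"
    by (simp add: permutes_swap_id)
  define x where "x = \<phi> $ ?p 1"
  define s where "s = sgn x"
  have z: "\<phi> $ ?p 3 = 0"
    using assms(1) by simp
  have y: "\<phi> $ ?p 2 = - x"
    using assms(2) sum.permute[OF p, of "($) \<phi>"] z unfolding sum_3 x_def o_def by simp
  have "2 * x\<^sup>2 = 1"
    using assms(3) sum.permute[OF p, of "\<lambda>i. (\<phi> $ i)\<^sup>2"] z y unfolding sum_3 x_def o_def by simp
  then have "\<bar>x\<bar>\<^sup>2 = (1 / sqrt 2)\<^sup>2"
    by (simp add: power_divide)
  then have "\<bar>x\<bar> = 1 / sqrt 2"
    by (subst (asm) power2_eq_iff_nonneg) auto
  then have s: "s \<in> {1, - 1}" and x: "x = s * (1 / sqrt 2)"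
    unfolding s_def by (auto simp: sgn_if abs_if split: if_splits)
  have "\<phi> $ ?p j = s * ((1 / sqrt 2) *\<^sub>R vector [1, - 1, 0] :: real ^ 3) $ j" for j
    using exhaust_3[of j] x y z by (auto simp: x_def[symmetric])
  \<comment> \<open>A transposition is its own inverse, so this moves \<open>?p\<close> to the other
    side, as the definition requires.\<close>
  from this[of "?p i" for i]
  have "\<phi> $ i = s * ((1 / sqrt 2) *\<^sub>R vector [1, - 1, 0] :: real ^ 3) $ ?p i" for i
    by (simp only: transpose_involutory)
  then show ?thesis
    using p s unfolding equal_up_to_perm_sign_def by blast
qed

section \<open>Completeness of the list\<close>

lemma unit_cell_breather_classification:
  assumes m: "m \<noteq> 0" and g: "g \<noteq> 0" and u: "unit_cell_breather m g \<phi> \<omega>"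
  shows "\<exists>\<psi>. equal_up_to_perm_sign \<phi> \<psi> \<and>
           (typeII m g \<psi> \<omega> \<or> typeIII m g \<psi> \<omega> \<or> typeIV m g \<psi> \<omega>)"
proof (cases "\<phi> $ 1 \<noteq> \<phi> $ 2 \<and> \<phi> $ 1 \<noteq> \<phi> $ 3 \<and> \<phi> $ 2 \<noteq> \<phi> $ 3")
  case True
  note d = unit_cell_breather_distinct[OF m g u]
  have S: "sum (($) \<phi>) UNIV = 0"
    using d(1) True unfolding sum_3 by simp
  have N: "(\<Sum>i\<in>UNIV. (\<phi> $ i)\<^sup>2) = 1"
    using u unfolding unit_cell_breather_iff by simp
  obtain k where "\<phi> $ k = 0"
    using d(2) True by blast
  then have eq: "equal_up_to_perm_sign \<phi> ((1 / sqrt 2) *\<^sub>R vector [1, - 1, 0])"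
    using S N by (rule opposite_pair_normal_form)
  then have "unit_cell_breather m g ((1 / sqrt 2) *\<^sub>R vector [1, - 1, 0]) \<omega>"
    using u equal_up_to_perm_sign_sym unit_cell_breather_invariant by blast
  \<comment> \<open>The frequency is read off at site 1, where the amplitude is non-zero.\<close>
  then have "\<omega> * (1 / sqrt 2) = g * (1 / sqrt 2) ^ 3 - m * (- (1 / sqrt 2))"
    unfolding unit_cell_breather_def by simp
  also have "\<dots> = (m + g / 2) * (1 / sqrt 2)"
    by (simp add: power3_eq_cube algebra_simps)
  finally have "\<omega> = m + g / 2"
    by simp
  then show ?thesis
    using eq unfolding typeIII_def by blast
next
  case False
  \<comment> \<open>Here \<open>i\<close> is the site left over by a coinciding pair.\<close>
  obtain i b where i: "\<And>l. l \<noteq> i \<Longrightarrow> \<phi> $ l = b"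
  proof -
    consider "\<phi> $ 1 = \<phi> $ 2" | "\<phi> $ 1 = \<phi> $ 3" | "\<phi> $ 2 = \<phi> $ 3"
      using False by blast
    then show ?thesis
      by cases (metis that exhaust_3)+
  qed
  \<comment> \<open>Otherwise the equation at \<open>i\<close> makes the sum \<open>2 * b\<close>
    vanish, hence all of \<open>\<phi>\<close>, against the norm.\<close>
  have "\<phi> $ i \<noteq> 0"
  proof
    assume 0: "\<phi> $ i = 0"
    have "m * sum (($) \<phi>) UNIV = 0"
      using u 0 unfolding unit_cell_breather_iff by (auto dest!: spec[of _ i])
    moreover have "sum (($) \<phi>) UNIV = 2 * b"
      using 0 i exhaust_3[of i] unfolding sum_3 by auto
    ultimately have "\<phi> $ l = 0" for l
      using m 0 i[of l] by (cases "l = i") auto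
    then show False
      using u unfolding unit_cell_breather_iff by simp
  qed
  then have eq: "equal_up_to_perm_sign \<phi> (vector [\<bar>\<phi> $ i\<bar>, sgn (\<phi> $ i) * b, sgn (\<phi> $ i) * b])"
    using i by (rule two_equal_normal_form)
  then have "unit_cell_breather m g (vector [\<bar>\<phi> $ i\<bar>, sgn (\<phi> $ i) * b, sgn (\<phi> $ i) * b]) \<omega>"
    using u equal_up_to_perm_sign_sym unit_cell_breather_invariant by blast
  from unit_cell_breather_two_equal[OF m g _ this] show ?thesis
    using eq by auto
qed

section \<open>The polynomial equation for the type II parameter\<close>

text \<open>The quadratic for \<open>b\<close> is the same for both signs \<open>\<sigma>\<close>;
  eliminating \<open>b\<close> between it and the norm leaves a condition on \<open>a\<close> alone.
  Only the ratio \<open>m / g\<close> enters.\<close>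

lemma typeII_parameter_sextic:
  assumes g: "g \<noteq> 0" and p: "typeII_parameter m g \<sigma> a"
  shows "3 * a ^ 6 + (4 * m / g - 4) * a ^ 4
           + (1 + 12 * m\<^sup>2 / g\<^sup>2 - 4 * m / g) * a\<^sup>2 - 8 * m\<^sup>2 / g\<^sup>2 = 0"
proof -
  define b where "b = typeII_amplitude m g \<sigma> a"
  define \<mu> where "\<mu> = m / g"
  have n: "a\<^sup>2 + 2 * b\<^sup>2 = 1"
    using p unfolding typeII_parameter_def b_def by auto
  have m: "m = \<mu> * g"
    using g by (simp add: \<mu>_def)
  have "g * (a * b\<^sup>2 + (a\<^sup>2 + 2 * \<mu>) * b + \<mu> * a) = 0"
    using typeII_parameter_quadratic[OF g p b_def] unfolding m by (simp add: algebra_simps)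
  then have q: "a * b\<^sup>2 + (a\<^sup>2 + 2 * \<mu>) * b + \<mu> * a = 0"
    using g by simp
  \<comment> \<open>Isolating the term linear in \<open>b\<close> and squaring leaves only even powers of \<open>b\<close>.\<close>
  have "(a\<^sup>2 + 2 * \<mu>)\<^sup>2 * b\<^sup>2 = a\<^sup>2 * (b\<^sup>2 + \<mu>)\<^sup>2"
    using q by algebra
  \<comment> \<open>Substitute \<open>b\<^sup>2 = (1 - a\<^sup>2) / 2\<close> and multiply by
    4.\<close>
  then have "3 * a ^ 6 + (4 * \<mu> - 4) * a ^ 4 + (1 + 12 * \<mu>\<^sup>2 - 4 * \<mu>) * a\<^sup>2 - 8 * \<mu>\<^sup>2 = 0"
    using n by algebra
  then show ?thesis
    by (simp add: \<mu>_def power_divide)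
qed

theorem mainTheorem4:
  fixes m g :: real
  assumes "m \<noteq> 0" and "g \<noteq> 0"
  shows "(\<nexists>\<phi> \<omega>. unit_cell_breather m g \<phi> \<omega> \<and>
            \<phi> $ 1 \<noteq> \<phi> $ 2 \<and> \<phi> $ 1 \<noteq> \<phi> $ 3 \<and> \<phi> $ 2 \<noteq> \<phi> $ 3 \<and>
            \<phi> $ 1 \<noteq> 0 \<and> \<phi> $ 2 \<noteq> 0 \<and> \<phi> $ 3 \<noteq> 0) \<and>
         (\<forall>\<phi> \<omega>. unit_cell_breather m g \<phi> \<omega> \<longleftrightarrow>
            (\<exists>\<psi>. equal_up_to_perm_sign \<phi> \<psi> \<and>
               (typeII m g \<psi> \<omega> \<or> typeIII m g \<psi> \<omega> \<or> typeIV m g \<psi> \<omega>))) \<and>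
         (\<forall>\<sigma> a. typeII_parameter m g \<sigma> a \<longrightarrow>
            3 * a ^ 6 + (4 * m / g - 4) * a ^ 4
              + (1 + 12 * m\<^sup>2 / g\<^sup>2 - 4 * m / g) * a\<^sup>2 - 8 * m\<^sup>2 / g\<^sup>2 = 0)"
proof (intro conjI)
  show "\<nexists>\<phi> \<omega>. unit_cell_breather m g \<phi> \<omega> \<and>
          \<phi> $ 1 \<noteq> \<phi> $ 2 \<and> \<phi> $ 1 \<noteq> \<phi> $ 3 \<and> \<phi> $ 2 \<noteq> \<phi> $ 3 \<and>
          \<phi> $ 1 \<noteq> 0 \<and> \<phi> $ 2 \<noteq> 0 \<and> \<phi> $ 3 \<noteq> 0"
    using unit_cell_breather_distinct(2)[OF assms] by blast
  \<comment> \<open>Left to right is the classification; for the converse, invariance reduces the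
    claim to the three normal forms.\<close>
  show "\<forall>\<phi> \<omega>. unit_cell_breather m g \<phi> \<omega> \<longleftrightarrow>
          (\<exists>\<psi>. equal_up_to_perm_sign \<phi> \<psi> \<and>
             (typeII m g \<psi> \<omega> \<or> typeIII m g \<psi> \<omega> \<or> typeIV m g \<psi> \<omega>))"
    using unit_cell_breather_classification[OF assms] unit_cell_breather_invariant
      typeII_breather[OF assms(2)] typeIII_breather typeIV_breather by blast
qed (use typeII_parameter_sextic[OF assms(2)] in blast)

end
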